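(* Let $a\in\mathbb Z^n_{>0}$ and let $f$ be a TP-function on $B(a)$. Then $f$ is submodular, i.e. $f(x+1_i)+f(x+1_j)\ge f(x)+f(x+1_i+1_j)$ for all $x$ and $i\ne j$ with all four vectors in $B(a)$, if and only if this inequality holds whenever $i\ne j$ and all four vectors $x,x+1_i,x+1_j,x+1_i+1_j$ belong to $Int(a)$.
   Context: $B(a)=\{x\in\mathbb Z^n:0\le x\le a\}$; $1_q$ the $q$-th unit vector. A TP-function on $B(a)$: $f$ with $f(x+1_i+1_k)+f(x+1_j)=\max\{f(x+1_i+1_j)+f(x+1_k),f(x+1_i)+f(x+1_j+1_k)\}$ for all $x$, $i<j<k$ with six vectors in $B(a)$, and $f(x+1_i+1_k)+f(x+1_j+1_\ell)=\max\{f(x+1_i+1_j)+f(x+1_k+1_\ell),f(x+1_i+1_\ell)+f(x+1_j+1_k)\}$ for all $x$, $i<j<k<\ell$ with six vectors in $B(a)$. For nonzero $x\in B(a)$, $c(x),d(x)$ are the least and greatest elements of $\{i:x_i\ne0\}$; $x$ is a fuzzy-interval if $x_i=a_i$ for all $c(x)<i<d(x)$. $Int(a)$ is the set of fuzzy-intervals together with the zero vector. *)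

theory Defs
  imports Complex_Main "HOL-Library.Function_Algebras"
begin

text \<open>
  A vector of \<open>\<int>\<^sup>n\<close> is a function \<open>nat \<Rightarrow> int\<close> that vanishes outside the index set
  \<open>{1..n}\<close>, so that equality of vectors is equality of functions; sums of vectors are the
  pointwise sums of \<open>Function_Algebras\<close>. The bound \<open>a\<close> is only read at the indices \<open>{1..n}\<close>.
\<close>

definition int_vecs :: "nat \<Rightarrow> (nat \<Rightarrow> int) set" where
  "int_vecs n = {x. \<forall>i. i \<notin> {1..n} \<longrightarrow> x i = 0}"

definition unit_vec :: "nat \<Rightarrow> nat \<Rightarrow> int" where
  "unit_vec q = (\<lambda>i. if i = q then 1 else 0)"

definition box_vecs :: "nat \<Rightarrow> (nat \<Rightarrow> int) \<Rightarrow> (nat \<Rightarrow> int) set" where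
  "box_vecs n a = {x \<in> int_vecs n. \<forall>i\<in>{1..n}. 0 \<le> x i \<and> x i \<le> a i}"

text \<open>
  Functions on the box are total functions on \<open>nat \<Rightarrow> int\<close> whose values outside the box are
  never used. As in the three- and four-term relations themselves, only the six vectors that occur
  are required to lie in the box; membership of \<open>x\<close> follows.
\<close>

definition TP_function :: "nat \<Rightarrow> (nat \<Rightarrow> int) \<Rightarrow> ((nat \<Rightarrow> int) \<Rightarrow> real) \<Rightarrow> bool" where
  "TP_function n a f \<longleftrightarrow>
    (\<forall>x. \<forall>i\<in>{1..n}. \<forall>j\<in>{1..n}. \<forall>k\<in>{1..n}.
       i < j \<and> j < k \<and>
       {x + unit_vec i + unit_vec k, x + unit_vec j,
        x + unit_vec i + unit_vec j, x + unit_vec k,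
        x + unit_vec i, x + unit_vec j + unit_vec k} \<subseteq> box_vecs n a \<longrightarrow>
       f (x + unit_vec i + unit_vec k) + f (x + unit_vec j) =
         max (f (x + unit_vec i + unit_vec j) + f (x + unit_vec k))
             (f (x + unit_vec i) + f (x + unit_vec j + unit_vec k))) \<and>
    (\<forall>x. \<forall>i\<in>{1..n}. \<forall>j\<in>{1..n}. \<forall>k\<in>{1..n}. \<forall>l\<in>{1..n}.
       i < j \<and> j < k \<and> k < l \<and>
       {x + unit_vec i + unit_vec k, x + unit_vec j + unit_vec l,
        x + unit_vec i + unit_vec j, x + unit_vec k + unit_vec l,
        x + unit_vec i + unit_vec l, x + unit_vec j + unit_vec k} \<subseteq> box_vecs n a \<longrightarrow>
       f (x + unit_vec i + unit_vec k) + f (x + unit_vec j + unit_vec l) =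
         max (f (x + unit_vec i + unit_vec j) + f (x + unit_vec k + unit_vec l))
             (f (x + unit_vec i + unit_vec l) + f (x + unit_vec j + unit_vec k)))"

definition supp :: "nat \<Rightarrow> (nat \<Rightarrow> int) \<Rightarrow> nat set" where
  "supp n x = {i \<in> {1..n}. x i \<noteq> 0}"

definition fuzzy_interval :: "nat \<Rightarrow> (nat \<Rightarrow> int) \<Rightarrow> (nat \<Rightarrow> int) \<Rightarrow> bool" where
  "fuzzy_interval n a x \<longleftrightarrow>
    x \<in> box_vecs n a \<and> x \<noteq> 0 \<and>
    (\<forall>i. Min (supp n x) < i \<and> i < Max (supp n x) \<longrightarrow> x i = a i)"

definition Int_vecs :: "nat \<Rightarrow> (nat \<Rightarrow> int) \<Rightarrow> (nat \<Rightarrow> int) set" where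
  "Int_vecs n a = insert 0 {x. fuzzy_interval n a x}"

definition submodular_on :: "nat \<Rightarrow> (nat \<Rightarrow> int) set \<Rightarrow> ((nat \<Rightarrow> int) \<Rightarrow> real) \<Rightarrow> bool" where
  "submodular_on n S f \<longleftrightarrow>
    (\<forall>x. \<forall>i\<in>{1..n}. \<forall>j\<in>{1..n}.
       i \<noteq> j \<and>
       {x, x + unit_vec i, x + unit_vec j, x + unit_vec i + unit_vec j} \<subseteq> S \<longrightarrow>
       f (x + unit_vec i) + f (x + unit_vec j) \<ge> f x + f (x + unit_vec i + unit_vec j))"

end

theory Submission
  imports Defs
begin

text \<open>
  For fixed \<open>x\<close> write \<open>D i j x\<close> for the submodular defect of the square at \<open>x\<close> in the directions
  \<open>i, j\<close>. The three-term relation at \<open>x\<close> for \<open>i < j < k\<close> says exactly that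
  \<open>D i k x = min (D i j x) (D j k x)\<close>, and equally that
  \<open>D i k (x + 1\<^sub>j) = min (D i j (x + 1\<^sub>k)) (D j k (x + 1\<^sub>i))\<close>.

  The squares inside \<open>Int(a)\<close> are those in directions \<open>p < q\<close> at vectors that are supported on
  \<open>[p, q]\<close> and saturated strictly between \<open>p\<close> and \<open>q\<close>. By induction on \<open>q - p\<close>, all defects within
  the support interval \<open>[p, q]\<close> are nonnegative: the second identity passes nonnegativity from
  \<open>D p q\<close> at a vector with larger \<open>j\<close>-th entry to \<open>D p j\<close> and \<open>D j q\<close>, and the first one
  passes it back to \<open>D p q\<close> at the smaller vector, so one can descend from the saturated vectors.
\<close>

definition submod_defect :: "((nat \<Rightarrow> int) \<Rightarrow> real) \<Rightarrow> nat \<Rightarrow> nat \<Rightarrow> (nat \<Rightarrow> int) \<Rightarrow> real" where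
  "submod_defect f i j x =
     f (x + unit_vec i) + f (x + unit_vec j) - f x - f (x + unit_vec i + unit_vec j)"

lemma submodular_on_imp_defect_nonneg:
  assumes "submodular_on n S f" "i \<in> {1..n}" "j \<in> {1..n}" "i \<noteq> j"
    and "{x, x + unit_vec i, x + unit_vec j, x + unit_vec i + unit_vec j} \<subseteq> S"
  shows "0 \<le> submod_defect f i j x"
  using assms(1)[unfolded submodular_on_def, rule_format, of i j x] assms(2-)
  unfolding submod_defect_def by linarith

lemma submodular_on_subset:
  assumes "S \<subseteq> T" "submodular_on n T f"
  shows "submodular_on n S f"
  unfolding submodular_on_def
proof (intro allI ballI impI)
  fix x i j assume ij: "i \<in> {1..n}" "j \<in> {1..n}"
    and *: "i \<noteq> j \<and> {x, x + unit_vec i, x + unit_vec j, x + unit_vec i + unit_vec j} \<subseteq> S"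
  have "0 \<le> submod_defect f i j x"
    by (rule submodular_on_imp_defect_nonneg[OF assms(2) ij conjunct1[OF *]
          subset_trans[OF conjunct2[OF *] assms(1)]])
  then show "f x + f (x + unit_vec i + unit_vec j) \<le> f (x + unit_vec i) + f (x + unit_vec j)"
    by (simp add: submod_defect_def)
qed

lemma submod_defect_commute: "submod_defect f i j x = submod_defect f j i x"
  by (simp add: submod_defect_def add_ac)

section \<open>Unit steps and squares in the box\<close>

lemma unit_vec_apply [simp]: "unit_vec q i = (if i = q then 1 else 0)"
  by (simp add: unit_vec_def)

lemma box_vecs_add_unit_vec:
  assumes "x \<in> box_vecs n a" "i \<in> {1..n}" "x i < a i"
  shows "x + unit_vec i \<in> box_vecs n a"
  using assms by (auto simp: box_vecs_def int_vecs_def)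

lemma box_vecs_diff_unit_vec:
  assumes "x \<in> box_vecs n a" "i \<in> {1..n}" "0 < x i"
  shows "x - unit_vec i \<in> box_vecs n a"
proof -
  have "x i - 1 \<le> a i" using assms(1)[unfolded box_vecs_def] assms(2) by force
  with assms show ?thesis by (auto simp: box_vecs_def int_vecs_def)
qed

lemma submod_square_in_box_iff:
  assumes "i \<in> {1..n}" "j \<in> {1..n}" "i \<noteq> j"
  shows "{x, x + unit_vec i, x + unit_vec j, x + unit_vec i + unit_vec j} \<subseteq> box_vecs n a
    \<longleftrightarrow> x \<in> box_vecs n a \<and> x i < a i \<and> x j < a j"
proof
  assume "{x, x + unit_vec i, x + unit_vec j, x + unit_vec i + unit_vec j} \<subseteq> box_vecs n a"
  then have "x \<in> box_vecs n a" "(x + unit_vec i) i \<le> a i" "(x + unit_vec j) j \<le> a j"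
    using assms unfolding box_vecs_def by blast+
  then show "x \<in> box_vecs n a \<and> x i < a i \<and> x j < a j" by simp
next
  assume "x \<in> box_vecs n a \<and> x i < a i \<and> x j < a j"
  with assms show "{x, x + unit_vec i, x + unit_vec j, x + unit_vec i + unit_vec j} \<subseteq> box_vecs n a"
    by (simp add: box_vecs_add_unit_vec)
qed

section \<open>The three-term relation as identities between defects\<close>

lemma TP_three_term:
  assumes "TP_function n a f" "1 \<le> i" "i < j" "j < k" "k \<le> n"
    and "x \<in> box_vecs n a" "x i < a i" "x j < a j" "x k < a k"
  shows "f (x + unit_vec i + unit_vec k) + f (x + unit_vec j) =
         max (f (x + unit_vec i + unit_vec j) + f (x + unit_vec k))
             (f (x + unit_vec i) + f (x + unit_vec j + unit_vec k))"
proof -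
  have "{x + unit_vec i + unit_vec k, x + unit_vec j, x + unit_vec i + unit_vec j, x + unit_vec k,
        x + unit_vec i, x + unit_vec j + unit_vec k} \<subseteq> box_vecs n a"
    using assms by (simp add: box_vecs_add_unit_vec)
  moreover have "i \<in> {1..n}" "j \<in> {1..n}" "k \<in> {1..n}" using assms by auto
  ultimately show ?thesis
    using assms(1)[unfolded TP_function_def, THEN conjunct1, rule_format, of i j k x] assms(3,4)
    by metis
qed

text \<open>The three squares are the faces of a unit cube at its bottom corner \<open>x\<close>.
  Subtracting both sides of the three-term relation from \<open>f (x + unit_vec i) + f (x + unit_vec
  j) + f (x + unit_vec k) - f x + f (x + unit_vec j)\<close> turns \<open>max\<close> into
  \<open>min\<close>.\<close>

lemma submod_defect_eq_min:
  assumes "TP_function n a f" "1 \<le> i" "i < j" "j < k" "k \<le> n"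
    and "x \<in> box_vecs n a" "x i < a i" "x j < a j" "x k < a k"
  shows "submod_defect f i k x = min (submod_defect f i j x) (submod_defect f j k x)"
  using TP_three_term[OF assms] unfolding submod_defect_def by linarith

text \<open>The same relation, read on the three faces of the cube that meet in its top
  corner.\<close>

lemma submod_defect_shift_eq_min:
  assumes "TP_function n a f" "1 \<le> i" "i < j" "j < k" "k \<le> n"
    and "x \<in> box_vecs n a" "x i < a i" "x j < a j" "x k < a k"
  shows "submod_defect f i k (x + unit_vec j) =
         min (submod_defect f i j (x + unit_vec k)) (submod_defect f j k (x + unit_vec i))"
proof -
  have swap: "x + unit_vec j + unit_vec i = x + unit_vec i + unit_vec j"
    "x + unit_vec k + unit_vec i = x + unit_vec i + unit_vec k"
    "x + unit_vec k + unit_vec j = x + unit_vec j + unit_vec k"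
    "x + unit_vec j + unit_vec i + unit_vec k = x + unit_vec i + unit_vec j + unit_vec k"
    "x + unit_vec i + unit_vec k + unit_vec j = x + unit_vec i + unit_vec j + unit_vec k"
    by (simp_all add: add_ac)
  show ?thesis
    using TP_three_term[OF assms] unfolding submod_defect_def swap by linarith
qed

text \<open>A minimum bounds each of its arguments from below, so the shifted identity at
  \<open>x - unit_vec k\<close> applies. Lowering the entry at \<open>k\<close> makes room there, so
  \<open>x\<close> itself may be saturated at \<open>k\<close>.\<close>

lemma submod_defect_nonneg_left:
  assumes "TP_function n a f" "1 \<le> i" "i < j" "j < k" "k \<le> n"
    and x: "x \<in> box_vecs n a" "x i < a i" "x j < a j" "0 < x k"
    and D: "0 \<le> submod_defect f i k (x - unit_vec k + unit_vec j)"
  shows "0 \<le> submod_defect f i j x"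
proof -
  let ?z = "x - unit_vec k"
  have "?z \<in> box_vecs n a" using assms by (intro box_vecs_diff_unit_vec) auto
  moreover have "x k \<le> a k" using assms by (auto simp: box_vecs_def)
  ultimately have "submod_defect f i k (?z + unit_vec j) =
      min (submod_defect f i j (?z + unit_vec k)) (submod_defect f j k (?z + unit_vec i))"
    using assms by (intro submod_defect_shift_eq_min) auto
  with D show ?thesis by simp
qed

lemma submod_defect_nonneg_right:
  assumes "TP_function n a f" "1 \<le> i" "i < j" "j < k" "k \<le> n"
    and x: "x \<in> box_vecs n a" "0 < x i" "x j < a j" "x k < a k"
    and D: "0 \<le> submod_defect f i k (x - unit_vec i + unit_vec j)"
  shows "0 \<le> submod_defect f j k x"
proof -
  let ?z = "x - unit_vec i"
  have "?z \<in> box_vecs n a" using assms by (intro box_vecs_diff_unit_vec) auto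
  moreover have "x i \<le> a i" using assms by (auto simp: box_vecs_def)
  ultimately have "submod_defect f i k (?z + unit_vec j) =
      min (submod_defect f i j (?z + unit_vec k)) (submod_defect f j k (?z + unit_vec i))"
    using assms by (intro submod_defect_shift_eq_min) auto
  with D show ?thesis by simp
qed

text \<open>The defect is symmetric in its directions, so it suffices to treat \<open>i < j\<close>,
  the order used by the relations.\<close>

lemma submodular_on_box_iff:
  "submodular_on n (box_vecs n a) f \<longleftrightarrow>
    (\<forall>x\<in>box_vecs n a. \<forall>i j. 1 \<le> i \<and> i < j \<and> j \<le> n \<and> x i < a i \<and> x j < a j
       \<longrightarrow> 0 \<le> submod_defect f i j x)" (is "_ \<longleftrightarrow> ?R")
proof
  assume L: "submodular_on n (box_vecs n a) f"
  show ?R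
  proof (intro ballI allI impI)
    fix x i j assume *: "x \<in> box_vecs n a" "1 \<le> i \<and> i < j \<and> j \<le> n \<and> x i < a i \<and> x j < a j"
    then have ij: "i \<in> {1..n}" "j \<in> {1..n}" "i \<noteq> j" by auto
    then show "0 \<le> submod_defect f i j x"
      using L * submod_square_in_box_iff[OF ij, of x a]
      by (blast intro: submodular_on_imp_defect_nonneg)
  qed
next
  assume R: ?R
  show "submodular_on n (box_vecs n a) f"
    unfolding submodular_on_def
  proof (intro allI ballI impI)
    fix x i j assume ij: "i \<in> {1..n}" "j \<in> {1..n}"
      and *: "i \<noteq> j \<and> {x, x + unit_vec i, x + unit_vec j, x + unit_vec i + unit_vec j} \<subseteq> box_vecs n a"
    then have "x \<in> box_vecs n a" "x i < a i" "x j < a j"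
      using submod_square_in_box_iff[OF ij, of x a] by blast+
    then have "0 \<le> submod_defect f i j x"
      using R ij * submod_defect_commute[of f i j x]
      by (metis atLeastAtMost_iff linorder_neqE_nat)
    then show "f x + f (x + unit_vec i + unit_vec j) \<le> f (x + unit_vec i) + f (x + unit_vec j)"
      by (simp add: submod_defect_def)
  qed
qed

section \<open>Squares inside \<open>Int_vecs\<close> and descent from them\<close>

text \<open>The entries at \<open>p\<close> and \<open>q\<close> may vanish: the support still lies
  in \<open>{p..q}\<close>, so anything strictly between its extremes is strictly between
  \<open>p\<close> and \<open>q\<close>. Hence one pair \<open>p, q\<close> serves all four corners
  of a square.\<close>

lemma in_Int_vecsI:
  assumes "y \<in> box_vecs n a" "\<And>i. i \<notin> {p..q} \<Longrightarrow> y i = 0" "\<And>i. p < i \<Longrightarrow> i < q \<Longrightarrow> y i = a i"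
  shows "y \<in> Int_vecs n a"
proof (cases "y = 0")
  case False
  then obtain i where "y i \<noteq> 0" by (auto simp: fun_eq_iff)
  moreover from this have "i \<in> {1..n}" using assms(1) unfolding box_vecs_def int_vecs_def by blast
  ultimately have ne: "supp n y \<noteq> {}" unfolding supp_def by blast
  have fin: "finite (supp n y)" by (simp add: supp_def)
  have "supp n y \<subseteq> {p..q}" using assms(2) unfolding supp_def by blast
  with Min_in[OF fin ne] Max_in[OF fin ne] have "p \<le> Min (supp n y)" "Max (supp n y) \<le> q" by auto
  then show ?thesis using assms(1,3) False by (simp add: Int_vecs_def fuzzy_interval_def)
qed (simp add: Int_vecs_def)

text \<open>Positivity of \<open>a\<close> enters through the zero vector.\<close>

lemma Int_vecs_subset_box_vecs:
  assumes "\<And>i. i \<in> {1..n} \<Longrightarrow> a i > 0"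
  shows "Int_vecs n a \<subseteq> box_vecs n a"
  using assms by (force simp: Int_vecs_def fuzzy_interval_def box_vecs_def int_vecs_def)

text \<open>Base of the descent: steps at \<open>p\<close> and \<open>q\<close> do not touch the
  saturated entries between them, so the whole square stays in \<open>Int_vecs\<close>.\<close>

lemma submod_defect_nonneg_saturated:
  assumes "submodular_on n (Int_vecs n a) f" "1 \<le> p" "p < q" "q \<le> n"
    and "x \<in> box_vecs n a" "\<And>i. i \<notin> {p..q} \<Longrightarrow> x i = 0" "\<And>i. p < i \<Longrightarrow> i < q \<Longrightarrow> x i = a i"
    and "x p < a p" "x q < a q"
  shows "0 \<le> submod_defect f p q x"
proof -
  have pq: "p \<in> {1..n}" "q \<in> {1..n}" "p \<noteq> q" using assms by auto
  have "{x, x + unit_vec p, x + unit_vec q, x + unit_vec p + unit_vec q} \<subseteq> box_vecs n a"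
    using submod_square_in_box_iff[OF pq] assms by blast
  then have "{x, x + unit_vec p, x + unit_vec q, x + unit_vec p + unit_vec q} \<subseteq> Int_vecs n a"
    using assms(3,6,7) by (auto intro!: in_Int_vecsI[of _ n a p q])
  with assms(1) pq show ?thesis by (rule submodular_on_imp_defect_nonneg)
qed

text \<open>
  The hypotheses \<open>L\<close> and \<open>R\<close> will be the induction hypotheses for the intervals \<open>[p, q - 1]\<close> and
  \<open>[p + 1, q]\<close>.
\<close>

lemma submod_defect_nonneg_outer:
  assumes TP: "TP_function n a f" and pq: "1 \<le> p" "p < q" "q \<le> n"
    and Int: "submodular_on n (Int_vecs n a) f"
    and L: "\<And>x j. x \<in> box_vecs n a \<Longrightarrow> (\<And>i. i \<notin> {p..<q} \<Longrightarrow> x i = 0) \<Longrightarrow> p < j \<Longrightarrow> j < q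
              \<Longrightarrow> x p < a p \<Longrightarrow> x j < a j \<Longrightarrow> 0 \<le> submod_defect f p j x"
    and R: "\<And>x j. x \<in> box_vecs n a \<Longrightarrow> (\<And>i. i \<notin> {p<..q} \<Longrightarrow> x i = 0) \<Longrightarrow> p < j \<Longrightarrow> j < q
              \<Longrightarrow> x j < a j \<Longrightarrow> x q < a q \<Longrightarrow> 0 \<le> submod_defect f j q x"
    and x: "x \<in> box_vecs n a" "\<And>i. i \<notin> {p..q} \<Longrightarrow> x i = 0" "x p < a p" "x q < a q"
  shows "0 \<le> submod_defect f p q x"
  using x
\<comment> \<open>The measure is the total shortfall from saturation strictly between
  \<open>p\<close> and \<open>q\<close>.\<close>
proof (induction "\<Sum>i\<in>{p<..<q}. nat (a i - x i)" arbitrary: x rule: less_induct)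
  case (less x)
  show ?case
  proof (cases "\<forall>i. p < i \<longrightarrow> i < q \<longrightarrow> x i = a i")
    case True
    then show ?thesis using submod_defect_nonneg_saturated[OF Int pq] less.prems by blast
  next
    case False
    then obtain j where "p < j" "j < q" "x j \<noteq> a j" by blast
    moreover from this have "x j \<le> a j" using pq less.prems(1) by (auto simp: box_vecs_def)
    ultimately have j: "p < j" "j < q" "x j < a j" by auto
    have x0: "0 \<le> x i" for i
      using less.prems(1) by (cases "i \<in> {1..n}") (auto simp: box_vecs_def int_vecs_def)
    \<comment> \<open>Moving a unit from an endpoint \<open>r\<close> to the unsaturated index
      \<open>j\<close> lowers the measure, because endpoints are not counted in it.\<close>
    have IH: "0 \<le> submod_defect f p q (x - unit_vec r + unit_vec j)"
      if r: "0 < x r" "r = p \<or> r = q" for r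
    proof -
      let ?y = "x - unit_vec r + unit_vec j"
      have rj: "r \<in> {1..n}" "j \<in> {1..n}" "j \<noteq> r" "r \<notin> {p<..<q}" using r(2) j pq by auto
      have "(\<Sum>i\<in>{p<..<q}. nat (a i - ?y i)) < (\<Sum>i\<in>{p<..<q}. nat (a i - x i))"
      proof (rule sum_strict_mono_ex1)
        show "\<forall>i\<in>{p<..<q}. nat (a i - ?y i) \<le> nat (a i - x i)" using rj(4) by auto
        have "nat (a j - ?y j) < nat (a j - x j)" using j rj(3) by simp
        then show "\<exists>i\<in>{p<..<q}. nat (a i - ?y i) < nat (a i - x i)" using j by
          (intro bexI[of _ j]) auto
      qed simp
      moreover have "?y \<in> box_vecs n a"
        using box_vecs_add_unit_vec[OF box_vecs_diff_unit_vec[OF less.prems(1) rj(1) r(1)] rj(2)] rj(3) j(3)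
        by simp
      moreover have "?y i = 0" if "i \<notin> {p..q}" for i
      proof -
        have "i \<noteq> j" "i \<noteq> r" using that j pq r(2) by auto
        then show ?thesis using less.prems(2)[OF that] by simp
      qed
      moreover have "?y p < a p" "?y q < a q" using j less.prems(3,4) by auto
      ultimately show ?thesis by (rule less.hyps)
    qed
    \<comment> \<open>Either \<open>x\<close> vanishes at \<open>q\<close> and lives on a shorter
      interval, or a unit at \<open>q\<close> can be moved to \<open>j\<close>.\<close>
    have "0 \<le> submod_defect f p j x"
    proof (cases "x q = 0")
      case True
      have "x i = 0" if "i \<notin> {p..<q}" for i
        using that True less.prems(2)[of i] by (cases "i = q") auto
      from L[OF less.prems(1) this j(1,2) less.prems(3) j(3)] show ?thesis by simp
    next
      case False
      then have "0 < x q" using x0[of q] by simp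
      then show ?thesis
        using submod_defect_nonneg_left[OF TP pq(1) j(1,2) pq(3) less.prems(1,3) j(3)] IH[of q] by simp
    qed
    moreover have "0 \<le> submod_defect f j q x"
    proof (cases "x p = 0")
      case True
      have "x i = 0" if "i \<notin> {p<..q}" for i
        using that True less.prems(2)[of i] by (cases "i = p") auto
      from R[OF less.prems(1) this j less.prems(4)] show ?thesis by simp
    next
      case False
      then have "0 < x p" using x0[of p] by simp
      then show ?thesis
        using submod_defect_nonneg_right[OF TP pq(1) j(1,2) pq(3) less.prems(1) _ j(3) less.prems(4)]
          IH[of p] by simp
    qed
    ultimately show ?thesis
      using submod_defect_eq_min[OF TP, of p j q x] pq j less.prems by simp
  qed
qed

text \<open>Induction on the length of an interval containing the support and both directions. On
  each interval the pair of endpoints comes first, then pairs with left member \<open>p\<close>,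
  then all pairs.\<close>

lemma submod_defect_nonneg_interval:
  assumes TP: "TP_function n a f" and Int: "submodular_on n (Int_vecs n a) f"
  shows "1 \<le> p \<Longrightarrow> p + m \<le> n \<Longrightarrow> x \<in> box_vecs n a \<Longrightarrow> (\<And>i. i \<notin> {p..p + m} \<Longrightarrow> x i = 0)
    \<Longrightarrow> p \<le> i \<Longrightarrow> i < j \<Longrightarrow> j \<le> p + m \<Longrightarrow> x i < a i \<Longrightarrow> x j < a j \<Longrightarrow> 0 \<le> submod_defect f i j x"
proof (induction m arbitrary: p x i j)
  case 0
  then show ?case by simp
next
  case (Suc m)
  define q where "q = p + Suc m"
  have pq: "1 \<le> p" "p < q" "q \<le> n" using Suc.prems by (auto simp: q_def)
  have L: "0 \<le> submod_defect f i j x"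
    if "x \<in> box_vecs n a" "\<And>i. i \<notin> {p..<q} \<Longrightarrow> x i = 0" "p \<le> i" "i < j" "j < q" "x i < a i" "x j < a j"
    for x i j
    using that pq by (intro Suc.IH[of p x i j]) (auto simp: q_def)
  have R: "0 \<le> submod_defect f i j x"
    if "x \<in> box_vecs n a" "\<And>i. i \<notin> {p<..q} \<Longrightarrow> x i = 0" "p < i" "i < j" "j \<le> q" "x i < a i" "x j < a j"
    for x i j
    using that pq by (intro Suc.IH[of "Suc p" x i j]) (auto simp: q_def)
  have outer: "0 \<le> submod_defect f p q x"
    if "x \<in> box_vecs n a" "\<And>i. i \<notin> {p..q} \<Longrightarrow> x i = 0" "x p < a p" "x q < a q" for x
    using submod_defect_nonneg_outer[OF TP pq Int, of x] L R that by auto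
  have x0: "0 \<le> x i" if "x \<in> box_vecs n a" for x i
    using that by (cases "i \<in> {1..n}") (auto simp: box_vecs_def int_vecs_def)
  have left: "0 \<le> submod_defect f p j x"
    if x: "x \<in> box_vecs n a" "\<And>i. i \<notin> {p..q} \<Longrightarrow> x i = 0" "p < j" "j \<le> q" "x p < a p" "x j < a j" for x j
  proof -
    consider "j = q" | "j < q" "x q = 0" | "j < q" "0 < x q"
      using x0[OF x(1), of q] x(4) by linarith
    then show ?thesis
    proof cases
      case 1
      then show ?thesis using outer x by simp
    next
      case 2
      then have "x i = 0" if "i \<notin> {p..<q}" for i using x(2)[of i] that by (cases "i = q") auto
      then show ?thesis using L 2 x by blast
    next
      case 3
      then have "x - unit_vec q + unit_vec j \<in> box_vecs n a"
        using x pq by (intro box_vecs_add_unit_vec box_vecs_diff_unit_vec) auto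
      \<comment> \<open>After the unit leaves \<open>q\<close>, this bound becomes the strict one
        that \<open>outer\<close> requires.\<close>
      moreover have "x q \<le> a q" using x pq by (auto simp: box_vecs_def)
      ultimately have "0 \<le> submod_defect f p q (x - unit_vec q + unit_vec j)"
        using x 3 by (intro outer) auto
      then show ?thesis using TP pq 3 x by (intro submod_defect_nonneg_left[of n a f p j q]) auto
    qed
  qed
  note x = Suc.prems(3-9)[folded q_def]
  consider "i = p" | "p < i" "x p = 0" | "p < i" "0 < x p"
    using x0[OF x(1), of p] x(3) by linarith
  then show ?case
  proof cases
    case 1
    then show ?thesis using left x by simp
  next
    case 2
    then have "x i = 0" if "i \<notin> {p<..q}" for i using x(2)[of i] that by (cases "i = p") auto
    then show ?thesis using R 2 x by blast
  next
    case 3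
    \<comment> \<open>Moving a unit from \<open>p\<close> to \<open>i\<close> reduces the directions
      \<open>i, j\<close> to the directions \<open>p, j\<close> settled by
      \<open>left\<close>.\<close>
    then have "x - unit_vec p + unit_vec i \<in> box_vecs n a"
      using x pq by (intro box_vecs_add_unit_vec box_vecs_diff_unit_vec) auto
    moreover have "x p \<le> a p" using x pq by (auto simp: box_vecs_def)
    ultimately have "0 \<le> submod_defect f p j (x - unit_vec p + unit_vec i)"
      using x 3 by (intro left) auto
    then show ?thesis using TP pq 3 x by (intro submod_defect_nonneg_right[of n a f p i j]) auto
  qed
qed

theorem theorem6p1:
  fixes n :: nat and a :: "nat \<Rightarrow> int" and f :: "(nat \<Rightarrow> int) \<Rightarrow> real"
  assumes "\<And>i. i \<in> {1..n} \<Longrightarrow> a i > 0"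
    and "TP_function n a f"
  shows "submodular_on n (box_vecs n a) f \<longleftrightarrow> submodular_on n (Int_vecs n a) f"
proof
  assume "submodular_on n (box_vecs n a) f"
  with Int_vecs_subset_box_vecs[OF assms(1)] show "submodular_on n (Int_vecs n a) f"
    by (rule submodular_on_subset)
next
  assume Int: "submodular_on n (Int_vecs n a) f"
  show "submodular_on n (box_vecs n a) f"
    unfolding submodular_on_box_iff
  proof (intro ballI allI impI)
    fix x i j assume "x \<in> box_vecs n a" "1 \<le> i \<and> i < j \<and> j \<le> n \<and> x i < a i \<and> x j < a j"
    then show "0 \<le> submod_defect f i j x"
      \<comment> \<open>The interval \<open>{1..1 + (n - 1)}\<close> is all of
        \<open>{1..n}\<close>, since \<open>i < j\<close> and \<open>j \<le> n\<close> force
        \<open>n\<close> to be positive.\<close>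
      by (intro submod_defect_nonneg_interval[OF assms(2) Int, of 1 "n - 1"])
        (auto simp: box_vecs_def int_vecs_def)
  qed
qed

end
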